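(* Let $0<r<1$ and let $T$ be an invertible bounded operator on a complex Hilbert space. Then $T\in C_\alpha$ if and only if the pair $\kappa(T)=\left(\frac{T}{\sqrt{1+r^2}},\frac{rT^{-1}}{\sqrt{1+r^2}}\right)$ is a spherical contraction.
   Context: $C_\alpha$ is the class of invertible bounded Hilbert space operators $T$ with $\alpha(T^*,T):=-T^{*2}T^2+(1+r^2)T^*T-r^2I\ge0$. A commuting tuple $(T_1,\dots,T_n)$ of bounded operators is a spherical contraction if $T_1^*T_1+\dots+T_n^*T_n\le I$. *)

theory Defs
  imports "HOL-Analysis.Analysis"
begin

class complex_vector = real_vector +
  fixes scaleC :: "complex \<Rightarrow> 'a \<Rightarrow> 'a" (infixr "*\<^sub>C" 75)
  assumes scaleC_add_right: "a *\<^sub>C (x + y) = a *\<^sub>C x + a *\<^sub>C y"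
    and scaleC_add_left: "(a + b) *\<^sub>C x = a *\<^sub>C x + b *\<^sub>C x"
    and scaleC_scaleC: "a *\<^sub>C b *\<^sub>C x = (a * b) *\<^sub>C x"
    and scaleC_one: "1 *\<^sub>C x = x"
    and scaleR_scaleC: "r *\<^sub>R x = complex_of_real r *\<^sub>C x"

text \<open>The inner product is linear in its first argument.  The axioms of
  \<^class>\<open>real_normed_vector\<close> follow from the inner product axioms; that class
  is included so that the norm and topology of the libraries are available.\<close>

class complex_inner = complex_vector + real_normed_vector +
  fixes cinner :: "'a \<Rightarrow> 'a \<Rightarrow> complex"
  assumes cinner_commute: "cinner x y = cnj (cinner y x)"
    and cinner_add_left: "cinner (x + y) z = cinner x z + cinner y z"
    and cinner_scaleC_left: "cinner (c *\<^sub>C x) y = c * cinner x y"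
    and cinner_ge_zero: "0 \<le> Re (cinner x x)"
    and cinner_eq_zero_iff: "cinner x x = 0 \<longleftrightarrow> x = 0"
    and norm_eq_sqrt_cinner: "norm x = sqrt (Re (cinner x x))"

class chilbert_space = complex_inner + complete_space

definition bounded_clinear :: "('a::complex_inner \<Rightarrow> 'b::complex_inner) \<Rightarrow> bool" where
  "bounded_clinear T \<longleftrightarrow> bounded_linear T \<and> (\<forall>c x. T (c *\<^sub>C x) = c *\<^sub>C T x)"

definition invertible_op :: "('a::complex_inner \<Rightarrow> 'a) \<Rightarrow> bool" where
  "invertible_op T \<longleftrightarrow>
     bounded_clinear T \<and> (\<exists>S. bounded_clinear S \<and> S \<circ> T = id \<and> T \<circ> S = id)"

text \<open>For a bounded operator on a Hilbert space, the Riesz representation theorem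
  gives existence of the map described here; uniqueness is definiteness of the inner product.\<close>

definition adj :: "('a::chilbert_space \<Rightarrow> 'a) \<Rightarrow> 'a \<Rightarrow> 'a" where
  "adj T = (THE S. \<forall>x y. cinner (T x) y = cinner x (S y))"

definition positive_op :: "('a::complex_inner \<Rightarrow> 'a) \<Rightarrow> bool" where
  "positive_op A \<longleftrightarrow>
     bounded_clinear A \<and> (\<forall>x. cinner (A x) x \<in> \<real> \<and> 0 \<le> Re (cinner (A x) x))"

definition alpha_op :: "real \<Rightarrow> ('a::chilbert_space \<Rightarrow> 'a) \<Rightarrow> 'a \<Rightarrow> 'a" where
  "alpha_op r T = (\<lambda>x. - (adj T ^^ 2) ((T ^^ 2) x) + (1 + r\<^sup>2) *\<^sub>R adj T (T x) - r\<^sup>2 *\<^sub>R x)"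

definition C_alpha :: "real \<Rightarrow> ('a::chilbert_space \<Rightarrow> 'a) set" where
  "C_alpha r = {T. invertible_op T \<and> positive_op (alpha_op r T)}"

text \<open>Operator tuples are lists.\<close>

definition spherical_contraction :: "('a::chilbert_space \<Rightarrow> 'a) list \<Rightarrow> bool" where
  "spherical_contraction Ts \<longleftrightarrow>
     (\<forall>T\<in>set Ts. bounded_clinear T) \<and>
     (\<forall>S\<in>set Ts. \<forall>T\<in>set Ts. S \<circ> T = T \<circ> S) \<and>
     positive_op (\<lambda>x. x - (\<Sum>T\<leftarrow>Ts. adj T (T x)))"

definition kappa :: "real \<Rightarrow> ('a::chilbert_space \<Rightarrow> 'a) \<Rightarrow> ('a \<Rightarrow> 'a) list" where
  "kappa r T =
     [\<lambda>x. (1 / sqrt (1 + r\<^sup>2)) *\<^sub>R T x, \<lambda>x. (r / sqrt (1 + r\<^sup>2)) *\<^sub>R inv T x]"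

end

theory Submission
  imports Defs
begin

text \<open>With \<open>y = T x\<close>, the quadratic form of \<open>\<alpha>(T\<^sup>*, T)\<close> at \<open>x\<close> is \<open>1 + r\<^sup>2\<close> times the
  quadratic form of \<open>I - T\<^sub>1\<^sup>*T\<^sub>1 - T\<^sub>2\<^sup>*T\<^sub>2\<close> at \<open>y\<close>, where \<open>(T\<^sub>1, T\<^sub>2) = \<kappa>(T)\<close>; since \<open>T\<close> is onto,
  one form is nonnegative iff the other is.  That these forms make sense rests on the existence of
  adjoints, i.e. the Riesz representation theorem.  It is obtained here by minimizing
  \<open>\<parallel>x\<parallel>\<^sup>2/2 - Re (f x)\<close>: by the parallelogram law minimizing sequences are Cauchy, and the
  stationarity of the minimizer \<open>z\<close> says that \<open>f = \<langle>\<sqdot>, z\<rangle>\<close>.\<close>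

section \<open>Complex inner products\<close>

lemma cinner_add_right: "cinner x (y + z) = cinner x y + cinner (x::'a::complex_inner) z"
  by (metis cinner_add_left cinner_commute complex_cnj_add)

lemma cinner_scaleC_right: "cinner x (c *\<^sub>C y) = cnj c * cinner (x::'a::complex_inner) y"
  by (metis cinner_scaleC_left cinner_commute complex_cnj_mult)

lemma cinner_scaleR_left: "cinner (a *\<^sub>R x) y = of_real a * cinner (x::'a::complex_inner) y"
  by (simp add: scaleR_scaleC cinner_scaleC_left)

lemma cinner_scaleR_right: "cinner x (a *\<^sub>R y) = of_real a * cinner (x::'a::complex_inner) y"
  by (simp add: scaleR_scaleC cinner_scaleC_right)

lemma cinner_minus_left: "cinner (- x) y = - cinner (x::'a::complex_inner) y"
  using cinner_scaleR_left[of "-1" x y] by simp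

lemma cinner_diff_left: "cinner (x - y) z = cinner x z - cinner (y::'a::complex_inner) z"
  using cinner_add_left[of x "- y" z] by (simp add: cinner_minus_left)

lemma cinner_diff_right: "cinner x (y - z) = cinner x y - cinner (x::'a::complex_inner) z"
  by (metis cinner_diff_left cinner_commute complex_cnj_diff)

lemma cinner_self: "cinner x x = of_real ((norm (x::'a::complex_inner))\<^sup>2)"
proof -
  have "Im (cinner x x) = 0"
    using arg_cong[OF cinner_commute[of x x], of Im] by simp
  moreover have "Re (cinner x x) = (norm x)\<^sup>2"
    by (simp add: norm_eq_sqrt_cinner cinner_ge_zero)
  ultimately show ?thesis
    by (simp add: complex_eq_iff)
qed

lemma norm_add_sq:
  "(norm (x + y))\<^sup>2 = (norm x)\<^sup>2 + 2 * Re (cinner x y) + (norm (y::'a::complex_inner))\<^sup>2"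
proof -
  have "Re (cinner (x + y) (x + y)) = Re (cinner x x) + 2 * Re (cinner x y) + Re (cinner y y)"
    using arg_cong[OF cinner_commute[of y x], of Re]
    by (simp add: cinner_add_left cinner_add_right)
  then show ?thesis
    by (simp add: cinner_self)
qed

lemma norm_scaleC: "norm (c *\<^sub>C x) = cmod c * norm (x::'a::complex_inner)"
proof -
  have "cinner (c *\<^sub>C x) (c *\<^sub>C x) = (c * cnj c) * cinner x x"
    by (simp only: cinner_scaleC_left cinner_scaleC_right mult_ac)
  also have "\<dots> = of_real ((cmod c)\<^sup>2) * of_real ((norm x)\<^sup>2)"
    by (simp only: cinner_self complex_norm_square)
  finally have "(norm (c *\<^sub>C x))\<^sup>2 = (cmod c * norm x)\<^sup>2"
    by (simp only: cinner_self of_real_mult[symmetric] of_real_eq_iff power_mult_distrib)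
  then show ?thesis
    by (simp add: power2_eq_iff_nonneg)
qed

lemma parallelogram_law:
  "(norm (x + y))\<^sup>2 + (norm (x - y))\<^sup>2 = 2 * (norm x)\<^sup>2 + 2 * (norm (y::'a::complex_inner))\<^sup>2"
  using norm_add_sq[of x y] norm_add_sq[of x "- y"]
    cinner_scaleR_right[of x "-1" y] by simp

text \<open>The triangle inequality is a class axiom here, so Cauchy--Schwarz can be derived from it.\<close>

lemma Re_cinner_le: "Re (cinner x y) \<le> norm x * norm (y::'a::complex_inner)"
proof -
  have "(norm (x + y))\<^sup>2 \<le> (norm x + norm y)\<^sup>2"
    by (simp add: norm_triangle_ineq power_mono)
  then show ?thesis
    by (simp add: norm_add_sq power2_sum)
qed

lemma cauchy_schwarz: "cmod (cinner x y) \<le> norm x * norm (y::'a::complex_inner)"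
proof -
  \<comment> \<open>Multiplying by the conjugate phase makes the inner product real and nonnegative.
    As \<open>sgn 0 = 0\<close>, \<open>c\<close> vanishes when the inner product does, so in
    general only \<open>cmod c \<le> 1\<close> holds, which suffices.\<close>
  define c where "c = cnj (sgn (cinner x y))"
  have "cinner (c *\<^sub>C x) y = of_real (cmod (cinner x y))"
    by (simp add: c_def cinner_scaleC_left sgn_eq complex_norm_square[symmetric]
        power2_eq_square mult.commute)
  then have "cmod (cinner x y) \<le> norm (c *\<^sub>C x) * norm y"
    using Re_cinner_le[of "c *\<^sub>C x" y] by simp
  also have "\<dots> \<le> norm x * norm y"
    by (intro mult_right_mono) (simp_all add: norm_scaleC c_def norm_sgn)
  finally show ?thesis .
qed

lemma bounded_linear_cinner_left: "bounded_linear (\<lambda>x::'a::complex_inner. cinner x y)"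
  by (rule bounded_linear_intro[where K = "norm y"])
    (simp_all add: cinner_add_left cinner_scaleR_left scaleR_conv_of_real cauchy_schwarz)

lemma cinner_right_cancel:
  assumes "\<And>x. cinner x y = cinner x (z::'a::complex_inner)"
  shows "y = z"
  using assms[of "y - z"] cinner_eq_zero_iff[of "y - z"] by (simp add: cinner_diff_right)

section \<open>Riesz representation and adjoints\<close>

text \<open>First-order optimality condition: for small \<open>t\<close> the linear term dominates
  and changes sign with \<open>t\<close>. It will extract the stationarity of the energy
  minimizer.\<close>

lemma linear_coeff_eq_zero:
  fixes a b :: real
  assumes "\<And>t. 0 \<le> t * a + t\<^sup>2 * b"
  shows "a = 0"
proof (rule ccontr)
  assume "a \<noteq> 0"
  \<comment> \<open>Any positive \<open>d > b\<close> works: at \<open>t = - a / d\<close> the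
    polynomial equals \<open>a\<^sup>2 * (b - d) / d\<^sup>2\<close>.\<close>
  define d where "d = \<bar>b\<bar> + 1"
  have "d > 0" "b < d" by (auto simp: d_def)
  have "0 \<le> (- a / d) * a + (- a / d)\<^sup>2 * b" by (rule assms)
  also have "\<dots> = a\<^sup>2 * (b - d) / d\<^sup>2"
    using \<open>d > 0\<close> by (simp add: field_simps power2_eq_square)
  also have "\<dots> < 0"
    using \<open>d > 0\<close> \<open>b < d\<close> \<open>a \<noteq> 0\<close> by (intro divide_neg_pos mult_pos_neg) auto
  finally show False by simp
qed

lemma energy_minimizer_exists:
  fixes f :: "'a::chilbert_space \<Rightarrow> complex"
  assumes "bounded_linear f"
  shows "\<exists>z. \<forall>x. (norm z)\<^sup>2 / 2 - Re (f z) \<le> (norm x)\<^sup>2 / 2 - Re (f x)"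
proof -
  interpret f: bounded_linear f by fact
  define J where "J x = (norm x)\<^sup>2 / 2 - Re (f x)" for x
  obtain K where K: "\<And>x. cmod (f x) \<le> norm x * K"
    using f.bounded by blast
  \<comment> \<open>Completing the square: \<open>J x\<close> is at least
    \<open>((norm x - K)\<^sup>2 - K\<^sup>2) / 2\<close>.\<close>
  have "- K\<^sup>2 / 2 \<le> J x" for x
  proof -
    have "Re (f x) \<le> norm x * K"
      using K[of x] complex_Re_le_cmod order_trans by blast
    moreover have "0 \<le> (norm x - K)\<^sup>2" by simp
    ultimately show ?thesis
      by (simp add: J_def power2_diff)
  qed
  then have bdd: "bdd_below (range J)"
    by (intro bdd_belowI) auto
  define m where "m = Inf (range J)"
  have lower: "m \<le> J x" for x
    unfolding m_def using bdd by (intro cInf_lower) auto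
  have "\<exists>x. J x < m + 1 / real (Suc n)" for n
    using cInf_lessD[of "range J" "m + 1 / real (Suc n)"] by (auto simp: m_def)
  then obtain X where X: "\<And>n. J (X n) < m + 1 / real (Suc n)"
    by metis
  \<comment> \<open>The real-linear term of \<open>J\<close> cancels here, leaving the parallelogram
    law. Since the midpoint has energy at least \<open>m\<close>, two points of nearly minimal
    energy must be close.\<close>
  have mid: "(dist x y)\<^sup>2 = 4 * (J x + J y - 2 * J ((1/2) *\<^sub>R (x + y)))" for x y
  proof -
    have "(norm ((1/2) *\<^sub>R (x + y)))\<^sup>2 = (norm (x + y))\<^sup>2 / 4"
      by (simp only: norm_scaleR power_mult_distrib) (simp add: power_divide)
    moreover have "Re (f ((1/2) *\<^sub>R (x + y))) = (Re (f x) + Re (f y)) / 2"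
      by (simp only: f.scaleR f.add) simp
    ultimately show ?thesis
      unfolding J_def dist_norm using parallelogram_law[of x y] by (simp add: field_simps)
  qed
  have close: "(dist (X i) (X j))\<^sup>2 < 4 * (1 / real (Suc i) + 1 / real (Suc j))" for i j
  proof -
    have "J (X i) + J (X j) - 2 * J ((1/2) *\<^sub>R (X i + X j)) < 1 / real (Suc i) + 1 / real (Suc j)"
      using add_strict_mono[OF X[of i] X[of j]] lower[of "(1/2) *\<^sub>R (X i + X j)"] by argo
    then show ?thesis
      unfolding mid by (rule mult_strict_left_mono) simp
  qed
  have "Cauchy X"
  proof (rule metric_CauchyI)
    fix e :: real assume "0 < e"
    \<comment> \<open>Beyond \<open>N\<close> both reciprocals in \<open>close\<close> are below
      \<open>e\<^sup>2 / 8\<close>, and 4 times their sum is below \<open>e\<^sup>2\<close>.\<close>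
    then obtain N where N: "1 / real (Suc N) < e\<^sup>2 / 8"
      using nat_approx_posE[of "e\<^sup>2 / 8"] by auto
    have "dist (X i) (X j) < e" if "N \<le> i" "N \<le> j" for i j
    proof -
      have "1 / real (Suc i) \<le> 1 / real (Suc N)" "1 / real (Suc j) \<le> 1 / real (Suc N)"
        using that by (auto intro!: divide_left_mono)
      then have "(dist (X i) (X j))\<^sup>2 < e\<^sup>2"
        using close[of i j] N by argo
      then show ?thesis
        using \<open>0 < e\<close> power_less_imp_less_base by fastforce
    qed
    then show "\<exists>M. \<forall>i\<ge>M. \<forall>j\<ge>M. dist (X i) (X j) < e" by blast
  qed
  then obtain z where z: "X \<longlonglongrightarrow> z"
    using Cauchy_convergent convergent_def by blast
  have "(\<lambda>n. J (X n)) \<longlonglongrightarrow> J z"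
    unfolding J_def by (intro tendsto_intros f.tendsto z) simp
  moreover have "(\<lambda>n. m + 1 / real (Suc n)) \<longlonglongrightarrow> m"
    using tendsto_add[OF tendsto_const LIMSEQ_inverse_real_of_nat, of m]
    by (simp add: inverse_eq_divide)
  ultimately have "J z \<le> m"
    by (rule LIMSEQ_le) (use X less_imp_le in blast)
  then show ?thesis
    using lower order_trans unfolding J_def by blast
qed

theorem riesz_representation:
  fixes f :: "'a::chilbert_space \<Rightarrow> complex"
  assumes "bounded_linear f" and scale: "\<And>c x. f (c *\<^sub>C x) = c * f x"
  shows "\<exists>z. \<forall>x. f x = cinner x z"
proof -
  interpret f: bounded_linear f by fact
  obtain z where z: "\<And>x. (norm z)\<^sup>2 / 2 - Re (f z) \<le> (norm x)\<^sup>2 / 2 - Re (f x)"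
    using energy_minimizer_exists[OF assms(1)] by blast
  have Re_eq: "Re (f x) = Re (cinner x z)" for x
  proof -
    \<comment> \<open>Minimality of \<open>z\<close> against the competitor \<open>z + t x\<close>,
      expanded in powers of \<open>t\<close>.\<close>
    have "0 \<le> t * (Re (cinner x z) - Re (f x)) + t\<^sup>2 * ((norm x)\<^sup>2 / 2)" for t
      using z[of "t *\<^sub>R x + z"] norm_add_sq[of "t *\<^sub>R x" z]
      by (simp add: f.add f.scaleR cinner_scaleR_left power_mult_distrib field_simps)
    then show ?thesis
      using linear_coeff_eq_zero by fastforce
  qed
  \<comment> \<open>Complex linearity recovers the imaginary part, because Re(i w) = - Im w.\<close>
  have "Im (f x) = Im (cinner x z)" for x
    using Re_eq[of "\<i> *\<^sub>C x"] by (simp add: scale cinner_scaleC_left)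
  then show ?thesis
    using Re_eq complex_eqI by blast
qed

lemma bounded_clinearD:
  assumes "bounded_clinear T"
  shows "bounded_linear T" "T (c *\<^sub>C x) = c *\<^sub>C T x"
  using assms by (auto simp: bounded_clinear_def)

text \<open>Makes the definite description in \<open>adj\<close> usable: Riesz applied to
  \<open>\<lambda>x. cinner (T x) y\<close> for each \<open>y\<close> gives existence, cancellation
  in the second argument gives uniqueness.\<close>

lemma cinner_adj:
  assumes T: "bounded_clinear (T::'a::chilbert_space \<Rightarrow> 'a)"
  shows "cinner (T x) y = cinner x (adj T y)"
proof -
  have "\<exists>z. \<forall>x. cinner (T x) y = cinner x z" for y
    using bounded_linear_compose[OF bounded_linear_cinner_left bounded_clinearD(1)[OF T]]
    by (intro riesz_representation) (simp_all add: bounded_clinearD(2)[OF T] cinner_scaleC_left)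
  then obtain S where S: "\<forall>x y. cinner (T x) y = cinner x (S y)"
    by metis
  have "\<forall>x y. cinner (T x) y = cinner x (adj T y)"
    unfolding adj_def
  proof (rule theI[of _ S])
    show "S' = S" if "\<forall>x y. cinner (T x) y = cinner x (S' y)" for S'
      using that S by (intro ext cinner_right_cancel) metis
  qed (rule S)
  then show ?thesis by blast
qed

lemma bounded_clinear_adj:
  assumes T: "bounded_clinear (T::'a::chilbert_space \<Rightarrow> 'a)"
  shows "bounded_clinear (adj T)"
proof -
  note adj = cinner_adj[OF T, symmetric]
  have add: "adj T (x + y) = adj T x + adj T y" for x y
    by (rule cinner_right_cancel) (simp add: adj cinner_add_right)
  have scaleC: "adj T (c *\<^sub>C x) = c *\<^sub>C adj T x" for c x
    by (rule cinner_right_cancel) (simp add: adj cinner_scaleC_right)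
  obtain K where K: "\<And>x. norm (T x) \<le> norm x * K"
    using bounded_linear.bounded[OF bounded_clinearD(1)[OF T]] by blast
  have "norm (adj T x) \<le> norm x * K" for x
  \<comment> \<open>The main estimate ends by cancelling a factor \<open>norm (adj T x)\<close>, so
    zero is separate. There \<open>norm x * K\<close> is nonnegative because it bounds
    \<open>norm (T x)\<close>; no sign of \<open>K\<close> is known.\<close>
  proof (cases "adj T x = 0")
    case True
    then show ?thesis using K[of x] norm_ge_zero[of "T x"] by (simp only: norm_zero)
  next
    case False
    have "(norm (adj T x))\<^sup>2 = Re (cinner (T (adj T x)) x)"
      by (simp add: cinner_adj[OF T] cinner_self)
    also have "\<dots> \<le> norm (T (adj T x)) * norm x"
      by (rule Re_cinner_le)
    also have "\<dots> \<le> norm (adj T x) * K * norm x"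
      by (intro mult_right_mono K) simp
    finally show ?thesis
      using False by (simp add: power2_eq_square mult_ac)
  qed
  then have "bounded_linear (adj T)"
    by (intro bounded_linear_intro[where K = K]) (simp_all add: add scaleC scaleR_scaleC)
  then show ?thesis
    by (simp add: bounded_clinear_def scaleC)
qed

section \<open>Bounded operators\<close>

lemma bounded_clinear_ident: "bounded_clinear (\<lambda>x. x)"
  by (simp add: bounded_clinear_def)

lemma bounded_clinear_compose:
  assumes "bounded_clinear S" "bounded_clinear T"
  shows "bounded_clinear (\<lambda>x. S (T x))"
  using assms by (simp add: bounded_clinear_def bounded_linear_compose)

lemma bounded_clinear_add:
  assumes "bounded_clinear S" "bounded_clinear T"
  shows "bounded_clinear (\<lambda>x. S x + T x)"
  using assms by (simp add: bounded_clinear_def bounded_linear_add scaleC_add_right)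

lemma bounded_clinear_scaleR:
  assumes "bounded_clinear T"
  shows "bounded_clinear (\<lambda>x. a *\<^sub>R T x)"
proof -
  have "bounded_linear (\<lambda>x. a *\<^sub>R T x)"
    by (intro bounded_linear_const_scaleR bounded_clinearD(1)[OF assms])
  then show ?thesis
    by (simp add: bounded_clinear_def bounded_clinearD(2)[OF assms] scaleR_scaleC scaleC_scaleC
        mult.commute)
qed

lemma bounded_clinear_diff:
  assumes "bounded_clinear S" "bounded_clinear T"
  shows "bounded_clinear (\<lambda>x. S x - T x)"
  using bounded_clinear_add[OF assms(1) bounded_clinear_scaleR[OF assms(2), of "-1"]] by simp

text \<open>\<open>kappa\<close> uses the choice-based \<open>inv T\<close>; a two-sided inverse is
  unique, so it coincides with the bounded inverse supplied by \<open>invertible_op\<close>.\<close>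

lemma invertible_op_inv:
  assumes "invertible_op T"
  shows "bounded_clinear (inv T)" "inv T (T x) = x" "T (inv T x) = x"
proof -
  obtain S where S: "bounded_clinear S" "S \<circ> T = id" "T \<circ> S = id"
    using assms by (auto simp: invertible_op_def)
  then have "inv T = S"
    using inv_unique_comp by blast
  then show "bounded_clinear (inv T)" "inv T (T x) = x" "T (inv T x) = x"
    using S by (simp_all add: pointfree_idE)
qed

lemma cinner_adj_self:
  assumes "bounded_clinear (T::'a::chilbert_space \<Rightarrow> 'a)"
  shows "cinner (adj T (T x)) x = of_real ((norm (T x))\<^sup>2)"
  by (metis assms cinner_adj cinner_commute cinner_self complex_cnj_complex_of_real)

section \<open>The two quadratic forms\<close>

text \<open>Boundedness and real-valuedness of the form are automatic once adjoints are bounded, so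
  positivity reduces to a sign condition on norms.\<close>

lemma positive_op_alpha_op_iff:
  assumes T: "bounded_clinear (T::'a::chilbert_space \<Rightarrow> 'a)"
  shows "positive_op (alpha_op r T) \<longleftrightarrow>
    (\<forall>x. 0 \<le> (1 + r\<^sup>2) * (norm (T x))\<^sup>2 - (norm (T (T x)))\<^sup>2 - r\<^sup>2 * (norm x)\<^sup>2)"
proof -
  note T' = bounded_clinear_adj[OF T]
  \<comment> \<open>Reordered as iterated differences, to match the closure rules for bounded
    operators.\<close>
  have eq: "alpha_op r T = (\<lambda>x. (1 + r\<^sup>2) *\<^sub>R adj T (T x) - adj T (adj T (T (T x))) - r\<^sup>2 *\<^sub>R x)"
    by (simp add: alpha_op_def numeral_2_eq_2 fun_eq_iff)
  have "bounded_clinear (alpha_op r T)"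
    unfolding eq
    by (intro bounded_clinear_diff bounded_clinear_scaleR bounded_clinear_ident
        bounded_clinear_compose[OF T'] bounded_clinear_compose[OF T] T)
  \<comment> \<open>Both adjoints move across the inner product, one at a time.\<close>
  moreover have "cinner (adj T (adj T (T (T x)))) x = of_real ((norm (T (T x)))\<^sup>2)" for x
    using cinner_adj[OF T] cinner_adj_self[OF T]
    by (metis cinner_commute cinner_self complex_cnj_complex_of_real)
  then have "cinner (alpha_op r T x) x =
      of_real ((1 + r\<^sup>2) * (norm (T x))\<^sup>2 - (norm (T (T x)))\<^sup>2 - r\<^sup>2 * (norm x)\<^sup>2)" for x
    by (simp add: eq cinner_diff_left cinner_scaleR_left cinner_adj_self[OF T] cinner_self)
  ultimately show ?thesis
    unfolding positive_op_def by (simp only: Reals_of_real Re_complex_of_real simp_thms)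
qed

lemma spherical_contraction_pair_iff:
  fixes A B :: "'a::chilbert_space \<Rightarrow> 'a"
  assumes A: "bounded_clinear A" and B: "bounded_clinear B" and comm: "A \<circ> B = B \<circ> A"
  shows "spherical_contraction [A, B] \<longleftrightarrow> (\<forall>x. (norm (A x))\<^sup>2 + (norm (B x))\<^sup>2 \<le> (norm x)\<^sup>2)"
proof -
  let ?D = "\<lambda>x. x - (\<Sum>T\<leftarrow>[A, B]. adj T (T x))"
  have "bounded_clinear ?D"
    using A B
    by (simp, intro bounded_clinear_diff bounded_clinear_add bounded_clinear_ident
        bounded_clinear_compose[OF bounded_clinear_adj])
  moreover have "cinner (?D x) x =
      of_real ((norm x)\<^sup>2 - ((norm (A x))\<^sup>2 + (norm (B x))\<^sup>2))" for x
    by (simp add: cinner_diff_left cinner_add_left cinner_adj_self[OF A] cinner_adj_self[OF B]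
        cinner_self)
  ultimately have "positive_op ?D \<longleftrightarrow> (\<forall>x. (norm (A x))\<^sup>2 + (norm (B x))\<^sup>2 \<le> (norm x)\<^sup>2)"
    unfolding positive_op_def
    by (simp only: Reals_of_real Re_complex_of_real simp_thms diff_ge_0_iff_ge)
  then show ?thesis
    unfolding spherical_contraction_def using A B comm by auto
qed

theorem proposition4p2:
  fixes r :: real and T :: "'a::chilbert_space \<Rightarrow> 'a"
  assumes "0 < r" and "r < 1" and "invertible_op T"
  shows "T \<in> C_alpha r \<longleftrightarrow> spherical_contraction (kappa r T)"
proof -
  have T: "bounded_clinear T"
    using assms(3) by (simp add: invertible_op_def)
  note inv = invertible_op_inv[OF assms(3)]
  interpret T: bounded_linear T by (rule bounded_clinearD(1)[OF T])
  interpret I: bounded_linear "inv T" by (rule bounded_clinearD(1)[OF inv(1)])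
  have pos: "0 < 1 + r\<^sup>2"
    by (simp add: add_pos_nonneg)
  have "T \<in> C_alpha r \<longleftrightarrow>
      (\<forall>x. 0 \<le> (1 + r\<^sup>2) * (norm (T x))\<^sup>2 - (norm (T (T x)))\<^sup>2 - r\<^sup>2 * (norm x)\<^sup>2)"
    using assms(3) by (simp add: C_alpha_def positive_op_alpha_op_iff[OF T])
  \<comment> \<open>Substitution \<open>y = T x\<close>, \<open>x = inv T y\<close>; both inverse
    identities are used, one for each direction.\<close>
  also have "\<dots> \<longleftrightarrow>
      (\<forall>y. 0 \<le> (1 + r\<^sup>2) * (norm y)\<^sup>2 - (norm (T y))\<^sup>2 - r\<^sup>2 * (norm (inv T y))\<^sup>2)"
    by (metis inv(2,3))
  also have "\<dots> \<longleftrightarrow>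
      (\<forall>y. (norm ((1 / sqrt (1 + r\<^sup>2)) *\<^sub>R T y))\<^sup>2 + (norm ((r / sqrt (1 + r\<^sup>2)) *\<^sub>R inv T y))\<^sup>2
        \<le> (norm y)\<^sup>2)"
  proof -
    have "(norm ((1 / sqrt (1 + r\<^sup>2)) *\<^sub>R T y))\<^sup>2 + (norm ((r / sqrt (1 + r\<^sup>2)) *\<^sub>R inv T y))\<^sup>2
        = ((norm (T y))\<^sup>2 + r\<^sup>2 * (norm (inv T y))\<^sup>2) / (1 + r\<^sup>2)" for y
      using pos by (simp add: power_mult_distrib power_divide add_divide_distrib)
    then show ?thesis
      using pos by (simp add: pos_divide_le_eq mult.commute diff_diff_eq)
  qed
  \<comment> \<open>The two operators commute, as both products are
    \<open>r / (1 + r\<^sup>2)\<close> times the identity.\<close>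
  also have "\<dots> \<longleftrightarrow> spherical_contraction (kappa r T)"
    unfolding kappa_def
    by (intro spherical_contraction_pair_iff[symmetric] bounded_clinear_scaleR T inv(1))
      (simp add: fun_eq_iff T.scaleR I.scaleR inv)
  finally show ?thesis .
qed

end
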